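(* Let $p>2$ be a prime and $n\ge1$. If a linear system over $\mathbb{Z}_p$ admits a solution in the extraspecial $p$-group $E_n^+$ (with respect to the central element $J_E$), then it admits a solution in $\mathbb{Z}_p$.
   Context: A linear system $(A,b)$ over $\mathbb{Z}_p$ consists of an $r\times c$ matrix $A$ over $\mathbb{Z}_p$ and $b\in\mathbb{Z}_p^r$. A solution in a group $G$ with a fixed central element $J_G$ of order $p$ is a tuple $T_1,\dots,T_c\in G$ with $T_j^p=1$ for all $j$; $T_jT_k=T_kT_j$ whenever $A_{ij}\neq0$ and $A_{ik}\neq0$ for some row $i$; and $\prod_{j}T_j^{A_{ij}}=J_G^{b_i}$ for all $1\le i\le r$. For $G=\mathbb{Z}_p$ one takes $J_G=1$, so this is an ordinary solution of $Ax=b$ over $\mathbb{Z}_p$. $E_1^+$ is the group of upper triangular $3\times3$ matrices over $\mathbb{Z}_p$ with $1$'s on the diagonal, and $E_n^+=E_1^+\ast\cdots\ast E_1^+$ ($n$ factors) is the central product identifying the centers; it has order $p^{2n+1}$ and center of order $p$. $J_E$ denotes a generator of the center of $E_n^+$. *)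

theory Defs
  imports
    "HOL-Algebra.Algebra"
    "Jordan_Normal_Form.Matrix"
    "Berlekamp_Zassenhaus.Finite_Field"
begin

text \<open>
  The field of integers modulo \<open>p\<close> is the type \<open>'p mod_ring\<close>, where \<open>'p\<close> is a type of prime
  cardinality \<open>p = CARD('p)\<close>.
\<close>

text \<open>
  \<open>A\<close> and \<open>b\<close> are indexed from 0, and only \<open>T j\<close> with \<open>j < dim_col A\<close> matters.  The exponent
  \<open>A $$ (i, j)\<close> is replaced by its representative in \<open>{0..<p}\<close>; this is harmless because
  \<open>T j\<close> and \<open>J\<close> have order dividing \<open>p\<close>.  The product over \<open>j\<close> is taken in increasing order of
  \<open>j\<close>, which is immaterial because the nontrivial factors of each row commute.
\<close>

definition is_solution ::
  "('g, 'm) monoid_scheme \<Rightarrow> 'g \<Rightarrow> 'p::prime_card mod_ring mat \<Rightarrow> 'p mod_ring vec \<Rightarrow> (nat \<Rightarrow> 'g) \<Rightarrow> bool"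
  where
  "is_solution G J A b T \<longleftrightarrow>
     (\<forall>j < dim_col A. T j \<in> carrier G) \<and>
     (\<forall>j < dim_col A. T j [^]\<^bsub>G\<^esub> CARD('p) = \<one>\<^bsub>G\<^esub>) \<and>
     (\<forall>j < dim_col A. \<forall>k < dim_col A.
        (\<exists>i < dim_row A. A $$ (i, j) \<noteq> 0 \<and> A $$ (i, k) \<noteq> 0) \<longrightarrow>
        T j \<otimes>\<^bsub>G\<^esub> T k = T k \<otimes>\<^bsub>G\<^esub> T j) \<and>
     (\<forall>i < dim_row A.
        foldr (\<lambda>j x. T j [^]\<^bsub>G\<^esub> to_int_mod_ring (A $$ (i, j)) \<otimes>\<^bsub>G\<^esub> x) [0..<dim_col A] \<one>\<^bsub>G\<^esub> =
        J [^]\<^bsub>G\<^esub> to_int_mod_ring (b $ i))"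

definition has_solution ::
  "('g, 'm) monoid_scheme \<Rightarrow> 'g \<Rightarrow> 'p::prime_card mod_ring mat \<Rightarrow> 'p mod_ring vec \<Rightarrow> bool"
  where "has_solution G J A b \<longleftrightarrow> (\<exists>T. is_solution G J A b T)"

text \<open>
  For the additive group of integers modulo \<open>p\<close> with \<open>J = 1\<close> (the residue class 1, not the
  neutral element) this is an ordinary solution of \<open>A x = b\<close>; see \<open>has_solution_Zp\<close>.
\<close>

lemma foldr_Zp:
  "of_int (foldr (\<lambda>j x. T j [^]\<^bsub>integer_mod_group CARD('p)\<^esub> to_int_mod_ring (a j :: 'p::prime_card mod_ring)
      \<otimes>\<^bsub>integer_mod_group CARD('p)\<^esub> x) xs \<one>\<^bsub>integer_mod_group CARD('p)\<^esub>) =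
   (\<Sum>j\<leftarrow>xs. a j * (of_int (T j) :: 'p mod_ring))"
proof (induction xs)
  case (Cons j xs)
  have m: "of_int (x mod int CARD('p)) = (of_int x :: 'p mod_ring)" for x
    by (metis of_int_of_int_mod_ring mod_mod_trivial of_int_mod_ring.abs_eq)
  have t: "of_int (to_int_mod_ring (a j)) = a j"
    by (metis of_int_of_int_mod_ring of_int_mod_ring_to_int_mod_ring)
  show ?case using Cons
    by (simp add: int_pow_integer_mod_group m t)
qed simp

lemma foldr_Zp_range:
  "foldr (\<lambda>j x. T j [^]\<^bsub>integer_mod_group CARD('p)\<^esub> to_int_mod_ring (a j :: 'p::prime_card mod_ring)
      \<otimes>\<^bsub>integer_mod_group CARD('p)\<^esub> x) xs \<one>\<^bsub>integer_mod_group CARD('p)\<^esub> \<in> {0..<int CARD('p)}"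
  by (cases xs) auto

lemma is_solution_Zp:
  fixes A :: "'p::prime_card mod_ring mat"
  assumes "A \<in> carrier_mat r c" "b \<in> carrier_vec r"
  shows "is_solution (integer_mod_group CARD('p)) 1 A b T \<longleftrightarrow>
    (\<forall>j<c. T j \<in> {0..<int CARD('p)}) \<and> A *\<^sub>v vec c (\<lambda>j. of_int (T j)) = b"
proof -
  let ?Z = "integer_mod_group CARD('p)"
  have pw: "x [^]\<^bsub>?Z\<^esub> CARD('p) = \<one>\<^bsub>?Z\<^esub>" for x
    by (simp add: pow_integer_mod_group)
  have cm: "x \<otimes>\<^bsub>?Z\<^esub> y = y \<otimes>\<^bsub>?Z\<^esub> x" for x y by (simp add: add.commute)
  have inj: "(x = y) \<longleftrightarrow> (of_int x = (of_int y :: 'p mod_ring))" 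
    if "x \<in> {0..<int CARD('p)}" "y \<in> {0..<int CARD('p)}" for x y
    using that by (metis atLeastLessThan_iff of_int_of_int_mod_ring to_int_mod_ring_of_int_mod_ring)
  have r: "to_int_mod_ring z \<in> {0..<int CARD('p)}" for z :: "'p mod_ring"
    using range_to_int_mod_ring by blast
  have t: "of_int (to_int_mod_ring z) = z" for z :: "'p mod_ring"
    by (metis of_int_of_int_mod_ring of_int_mod_ring_to_int_mod_ring)
  have J: "1 [^]\<^bsub>?Z\<^esub> to_int_mod_ring z = to_int_mod_ring z" for z :: "'p mod_ring"
    using r[of z] by (simp add: int_pow_integer_mod_group)
  have row: "(foldr (\<lambda>j x. T j [^]\<^bsub>?Z\<^esub> to_int_mod_ring (A $$ (i, j)) \<otimes>\<^bsub>?Z\<^esub> x) [0..<c] \<one>\<^bsub>?Z\<^esub> =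
     to_int_mod_ring (b $ i)) \<longleftrightarrow> (A *\<^sub>v vec c (\<lambda>j. of_int (T j))) $ i = b $ i" if "i < r" for i
    unfolding inj[OF foldr_Zp_range r] foldr_Zp t using that assms
    by (simp add: scalar_prod_def row_def sum_list_distinct_conv_sum_set interv_sum_list_conv_sum_set_nat)
  have d: "dim_row A = r" "dim_col A = c" "dim_vec b = r" using assms by auto
  have e: "A *\<^sub>v vec c (\<lambda>j. of_int (T j)) = b \<longleftrightarrow>
     (\<forall>i<r. (A *\<^sub>v vec c (\<lambda>j. of_int (T j))) $ i = b $ i)"
    using d by (auto simp: vec_eq_iff)
  have cr: "carrier ?Z = {0..<int CARD('p)}" by (simp add: carrier_integer_mod_group)
  show ?thesis unfolding is_solution_def d pw J e cr using row cm by auto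
qed

lemma has_solution_Zp:
  fixes A :: "'p::prime_card mod_ring mat"
  assumes "A \<in> carrier_mat r c" "b \<in> carrier_vec r"
  shows "has_solution (integer_mod_group CARD('p)) 1 A b \<longleftrightarrow> (\<exists>x \<in> carrier_vec c. A *\<^sub>v x = b)"
proof
  assume "has_solution (integer_mod_group CARD('p)) 1 A b"
  then show "\<exists>x \<in> carrier_vec c. A *\<^sub>v x = b"
    unfolding has_solution_def is_solution_Zp[OF assms] by (metis vec_carrier)
next
  assume "\<exists>x \<in> carrier_vec c. A *\<^sub>v x = b"
  then obtain x where x: "x \<in> carrier_vec c" "A *\<^sub>v x = b" by blast
  have t: "of_int (to_int_mod_ring z) = z" for z :: "'p mod_ring"
    by (metis of_int_of_int_mod_ring of_int_mod_ring_to_int_mod_ring)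
  have "vec c (\<lambda>j. of_int (to_int_mod_ring (x $ j))) = x" using x(1) t by auto
  moreover have "to_int_mod_ring z \<in> {0..<int CARD('p)}" for z :: "'p mod_ring"
    using range_to_int_mod_ring by blast
  ultimately show "has_solution (integer_mod_group CARD('p)) 1 A b"
    unfolding has_solution_def is_solution_Zp[OF assms] using x(2)
    by (intro exI[of _ "\<lambda>j. to_int_mod_ring (x $ j)"]) auto
qed

definition center :: "('g, 'm) monoid_scheme \<Rightarrow> 'g set"
  where "center G = {z \<in> carrier G. \<forall>g \<in> carrier G. z \<otimes>\<^bsub>G\<^esub> g = g \<otimes>\<^bsub>G\<^esub> z}"

text \<open>
  The central product of \<open>n\<close> copies of \<open>G\<close>: identifying the centers amounts to dividing the
  direct product by the tuples of central elements whose product is trivial.  The product of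
  these tuples is formed in the center of \<open>G\<close>, as \<open>finprod\<close> requires a commutative structure.
\<close>

definition central_power :: "('g, 'm) monoid_scheme \<Rightarrow> nat \<Rightarrow> (nat \<Rightarrow> 'g) set monoid"
  where
  "central_power G n =
     product_group {..<n} (\<lambda>_. G) Mod
       {z \<in> {..<n} \<rightarrow>\<^sub>E center G. finprod (G\<lparr>carrier := center G\<rparr>) z {..<n} = \<one>\<^bsub>G\<^esub>}"

definition E1_plus :: "'p::prime_card mod_ring mat monoid"
  where
  "E1_plus = \<lparr>carrier = {M \<in> carrier_mat 3 3. upper_triangular M \<and> (\<forall>i < 3. M $$ (i, i) = 1)},
              monoid.mult = (*), one = 1\<^sub>m 3\<rparr>"

definition E_plus :: "nat \<Rightarrow> (nat \<Rightarrow> 'p::prime_card mod_ring mat) set monoid"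
  where "E_plus n = central_power E1_plus n"

end

theory Submission
  imports Defs
begin

text \<open>
  The idea is to replace a solution in the extraspecial group by its logarithm.  In odd
  characteristic, an element of \<open>E1_plus\<close> with entries \<open>a\<close>, \<open>b\<close> above the diagonal and \<open>c\<close> in
  the corner has a matrix logarithm whose corner entry is \<open>\<phi> = c - a b / 2\<close>, and
  \<open>\<phi> (x y) = \<phi> x + \<phi> y + \<omega> (x, y) / 2\<close> for the alternating form \<open>\<omega> = a b' - a' b\<close>.  This form
  is the corner entry of the commutator, so \<open>\<phi>\<close> is additive on commuting pairs, although it is not a homomorphism.
  A linear system only multiplies commuting elements.  Hence applying \<open>\<phi>\<close> to a solution
  \<open>T\<close> turns the equation \<open>\<Prod>\<^sub>j T\<^sub>j ^ A\<^sub>i\<^sub>j = J ^ b\<^sub>i\<close> into \<open>\<Sum>\<^sub>j A\<^sub>i\<^sub>j \<phi> T\<^sub>j = b\<^sub>i \<phi> J\<close>, and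
  \<open>\<phi> T\<^sub>j / \<phi> J\<close> solves the system as soon as \<open>\<phi> J \<noteq> 0\<close> (\<open>has_solution_Zp_if_jordan_additive\<close>).

  To carry \<open>\<phi>\<close> from \<open>E1_plus\<close> to the central product, the form \<open>\<omega>\<close> is eliminated: since it is
  alternating, \<open>\<phi> (x y) + \<phi> (y x) = 2 (\<phi> x + \<phi> y)\<close> holds for all \<open>x\<close> and \<open>y\<close>.  This identity
  passes to direct products, by summing over the factors, and to quotients by central subgroups
  on which the function vanishes; together these give \<open>jordan_additive_central_power\<close>.
  Finally, the center contains an element of value 1, the class of an elementary matrix in
  one factor.  It is a power \<open>J ^ k\<close> of the generator, so \<open>k \<phi> J = 1\<close> and \<open>\<phi> J \<noteq> 0\<close>.
\<close>

section \<open>Functions additive on commuting pairs\<close>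

text \<open>
  Additivity is required only after symmetrizing, as for the Jordan product \<open>x y + y x\<close> of an
  associative algebra.  A condition on commuting pairs alone would be too weak: elements of a
  quotient may commute although their representatives do not.
\<close>

definition jordan_additive :: "('g, 'm) monoid_scheme \<Rightarrow> ('g \<Rightarrow> 'f::field) \<Rightarrow> bool"
  where "jordan_additive G \<phi> \<longleftrightarrow> (\<forall>x\<in>carrier G. \<forall>y\<in>carrier G.
    \<phi> (x \<otimes>\<^bsub>G\<^esub> y) + \<phi> (y \<otimes>\<^bsub>G\<^esub> x) = 2 * (\<phi> x + \<phi> y))"

lemma jordan_additive_mult_commuting:
  fixes \<phi> :: "'g \<Rightarrow> 'f::field"
  assumes "jordan_additive G \<phi>" "(2::'f) \<noteq> 0" "x \<in> carrier G" "y \<in> carrier G"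
    and "x \<otimes>\<^bsub>G\<^esub> y = y \<otimes>\<^bsub>G\<^esub> x"
  shows "\<phi> (x \<otimes>\<^bsub>G\<^esub> y) = \<phi> x + \<phi> y"
proof -
  have "2 * \<phi> (x \<otimes>\<^bsub>G\<^esub> y) = 2 * (\<phi> x + \<phi> y)"
    using assms unfolding jordan_additive_def mult_2 by metis
  then show ?thesis using assms(2) mult_left_cancel by blast
qed

lemma center_carrier: "z \<in> center G \<Longrightarrow> z \<in> carrier G"
  by (simp add: center_def)

lemma center_commute: "z \<in> center G \<Longrightarrow> g \<in> carrier G \<Longrightarrow> z \<otimes>\<^bsub>G\<^esub> g = g \<otimes>\<^bsub>G\<^esub> z"
  unfolding center_def by blast

lemma centerI:
  assumes "z \<in> carrier G" "\<And>g. g \<in> carrier G \<Longrightarrow> z \<otimes>\<^bsub>G\<^esub> g = g \<otimes>\<^bsub>G\<^esub> z"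
  shows "z \<in> center G"
  using assms unfolding center_def by blast

context group
begin

lemma jordan_additive_one:
  fixes \<phi> :: "'a \<Rightarrow> 'f::field"
  assumes "jordan_additive G \<phi>" "(2::'f) \<noteq> 0"
  shows "\<phi> \<one> = 0"
proof -
  have "\<phi> (\<one> \<otimes> \<one>) = \<phi> \<one> + \<phi> \<one>"
    using assms by (intro jordan_additive_mult_commuting) auto
  then show ?thesis by (metis add_cancel_left_right one_closed r_one)
qed

lemma jordan_additive_nat_pow:
  fixes \<phi> :: "'a \<Rightarrow> 'f::field"
  assumes "jordan_additive G \<phi>" "(2::'f) \<noteq> 0" "x \<in> carrier G"
  shows "\<phi> (x [^] (k::nat)) = of_nat k * \<phi> x"
proof (induction k)
  case 0
  then show ?case by (simp add: jordan_additive_one[OF assms(1,2)])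
next
  case (Suc k)
  have "\<phi> (x [^] k \<otimes> x) = \<phi> (x [^] k) + \<phi> x"
    using assms nat_pow_Suc2[of x k] by (intro jordan_additive_mult_commuting) auto
  with Suc show ?case by (simp add: algebra_simps)
qed

lemma jordan_additive_inv:
  fixes \<phi> :: "'a \<Rightarrow> 'f::field"
  assumes "jordan_additive G \<phi>" "(2::'f) \<noteq> 0" "x \<in> carrier G"
  shows "\<phi> (inv x) = - \<phi> x"
proof -
  have "\<phi> (inv x \<otimes> x) = \<phi> (inv x) + \<phi> x"
    using assms by (intro jordan_additive_mult_commuting) auto
  then show ?thesis
    using assms by (simp add: jordan_additive_one[OF assms(1,2)] eq_neg_iff_add_eq_0)
qed

lemma jordan_additive_int_pow:
  fixes \<phi> :: "'a \<Rightarrow> 'f::field"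
  assumes "jordan_additive G \<phi>" "(2::'f) \<noteq> 0" "x \<in> carrier G"
  shows "\<phi> (x [^] (k::int)) = of_int k * \<phi> x"
  using assms
  by (cases k rule: int_cases2)
    (auto simp: int_pow_int int_pow_neg_int jordan_additive_nat_pow jordan_additive_inv)

text \<open>
  The products over the rows of a linear system are right folds.  Before \<open>\<phi>\<close> can be split off
  factor by factor, each factor must be known to commute with the product of the later ones.
\<close>

lemma commute_foldr:
  assumes "y \<in> carrier G" "\<And>j. j \<in> set js \<Longrightarrow> u j \<in> carrier G"
    and "\<And>j. j \<in> set js \<Longrightarrow> y \<otimes> u j = u j \<otimes> y"
  shows "foldr (\<lambda>j x. u j \<otimes> x) js \<one> \<in> carrier G \<and>
    y \<otimes> foldr (\<lambda>j x. u j \<otimes> x) js \<one> = foldr (\<lambda>j x. u j \<otimes> x) js \<one> \<otimes> y"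
  using assms(2,3)
proof (induction js)
  case Nil
  then show ?case using assms(1) by simp
next
  case (Cons j js)
  define z where "z = foldr (\<lambda>j x. u j \<otimes> x) js \<one>"
  have z: "z \<in> carrier G" "y \<otimes> z = z \<otimes> y" using Cons unfolding z_def by auto
  have u: "u j \<in> carrier G" "y \<otimes> u j = u j \<otimes> y" using Cons.prems by auto
  have "y \<otimes> (u j \<otimes> z) = u j \<otimes> z \<otimes> y"
    using z u assms(1) by (metis m_assoc)
  then show ?case using z u by (simp flip: z_def)
qed

lemma jordan_additive_foldr:
  fixes \<phi> :: "'a \<Rightarrow> 'f::field"
  assumes "jordan_additive G \<phi>" "(2::'f) \<noteq> 0"
    and "\<And>j. j \<in> set js \<Longrightarrow> u j \<in> carrier G"
    and "\<And>j k. j \<in> set js \<Longrightarrow> k \<in> set js \<Longrightarrow> u j \<otimes> u k = u k \<otimes> u j"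
  shows "\<phi> (foldr (\<lambda>j x. u j \<otimes> x) js \<one>) = (\<Sum>j\<leftarrow>js. \<phi> (u j))"
  using assms(3,4)
proof (induction js)
  case Nil
  then show ?case by (simp add: jordan_additive_one[OF assms(1,2)])
next
  case (Cons j js)
  have "foldr (\<lambda>j x. u j \<otimes> x) js \<one> \<in> carrier G \<and>
    u j \<otimes> foldr (\<lambda>j x. u j \<otimes> x) js \<one> = foldr (\<lambda>j x. u j \<otimes> x) js \<one> \<otimes> u j"
    using Cons.prems by (intro commute_foldr) auto
  with Cons jordan_additive_mult_commuting[OF assms(1,2), of "u j" "foldr (\<lambda>j x. u j \<otimes> x) js \<one>"]
  show ?case by simp
qed

lemma int_pow_commute:
  assumes "x \<in> carrier G" "y \<in> carrier G" "x \<otimes> y = y \<otimes> x"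
  shows "x [^] (k::int) \<otimes> y [^] (l::int) = y [^] l \<otimes> x [^] k"
proof -
  have pow: "a [^] (k::int) \<otimes> b = b \<otimes> a [^] k"
    if a: "a \<in> carrier G" "b \<in> carrier G" "a \<otimes> b = b \<otimes> a" for a b k
  proof -
    have ia: "inv a \<otimes> b = b \<otimes> inv a"
      using a by (metis inv_closed inv_solve_left inv_solve_right m_assoc m_closed)
    have n: "c [^] (n::nat) \<otimes> b = b \<otimes> c [^] n"
      if "c \<in> carrier G" "c \<otimes> b = b \<otimes> c" for c n
      using that a(2) group_commutes_pow by blast
    show ?thesis
      by (cases k rule: int_cases2)
        (use n[OF a(1,3)] n[OF _ ia] a in
          \<open>auto simp: int_pow_int int_pow_neg_int simp flip: nat_pow_inv\<close>)
  qed
  show ?thesis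
    using pow[of y x l] pow[of x "y [^] l" k] assms by auto
qed

end

section \<open>Linear systems over the integers modulo an odd prime\<close>

lemma two_neq_zero_mod_ring:
  assumes "CARD('p::prime_card) > 2"
  shows "(2::'p mod_ring) \<noteq> 0"
proof
  assume "(2::'p mod_ring) = 0"
  then have "of_nat 2 = (0::'p mod_ring)" by simp
  then have "CARD('p) dvd 2"
    unfolding of_nat_eq_0_iff_char_dvd by simp
  then show False using assms by (auto dest: dvd_imp_le)
qed

text \<open>
  A row multiplies powers of pairwise commuting elements only, so \<open>\<phi>\<close> maps its equation to the
  same linear equation between values of \<open>\<phi>\<close>, with the right-hand side scaled by \<open>\<phi> J\<close>.
\<close>

lemma has_solution_Zp_if_jordan_additive:
  fixes A :: "'p::prime_card mod_ring mat" and \<phi> :: "'g \<Rightarrow> 'p mod_ring"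
  assumes "CARD('p) > 2" "group G" "jordan_additive G \<phi>"
    and J: "J \<in> carrier G" "\<phi> J \<noteq> 0"
    and A: "A \<in> carrier_mat r c" and b: "b \<in> carrier_vec r"
    and sol: "has_solution G J A b"
  shows "has_solution (integer_mod_group CARD('p)) 1 A b"
proof -
  interpret group G by fact
  note two = two_neq_zero_mod_ring[OF assms(1)]
  note pow = jordan_additive_int_pow[OF assms(3) two]
  have t: "of_int (to_int_mod_ring z) = z" for z :: "'p mod_ring"
    by (metis of_int_of_int_mod_ring of_int_mod_ring_to_int_mod_ring)
  obtain T where "is_solution G J A b T"
    using sol unfolding has_solution_def by blast
  then have T: "\<And>j. j < c \<Longrightarrow> T j \<in> carrier G"
    and comm: "\<And>i j k. i < r \<Longrightarrow> j < c \<Longrightarrow> k < c \<Longrightarrow> A $$ (i, j) \<noteq> 0 \<Longrightarrow> A $$ (i, k) \<noteq> 0 \<Longrightarrow>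
      T j \<otimes>\<^bsub>G\<^esub> T k = T k \<otimes>\<^bsub>G\<^esub> T j"
    and row: "\<And>i. i < r \<Longrightarrow>
      foldr (\<lambda>j x. T j [^]\<^bsub>G\<^esub> to_int_mod_ring (A $$ (i, j)) \<otimes>\<^bsub>G\<^esub> x) [0..<c] \<one>\<^bsub>G\<^esub> =
      J [^]\<^bsub>G\<^esub> to_int_mod_ring (b $ i)"
    using A unfolding is_solution_def by auto
  define x where "x = vec c (\<lambda>j. \<phi> (T j) / \<phi> J)"
  have "(A *\<^sub>v x) $ i = b $ i" if i: "i < r" for i
  proof -
    let ?u = "\<lambda>j. T j [^]\<^bsub>G\<^esub> to_int_mod_ring (A $$ (i, j))"
    have u: "?u j \<otimes>\<^bsub>G\<^esub> ?u k = ?u k \<otimes>\<^bsub>G\<^esub> ?u j" if "j < c" "k < c" for j k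
      \<comment> \<open>The system makes only the variables that occur in row \<open>i\<close> commute; the other factors are \<open>\<one>\<close>.\<close>
    proof (cases "A $$ (i, j) = 0 \<or> A $$ (i, k) = 0")
      case True
      then show ?thesis using T that by auto
    next
      case False
      then show ?thesis using comm[OF i that] T that by (intro int_pow_commute) auto
    qed
    have "b $ i * \<phi> J = \<phi> (J [^]\<^bsub>G\<^esub> to_int_mod_ring (b $ i))"
      by (simp add: pow J t)
    also have "\<dots> = \<phi> (foldr (\<lambda>j x. ?u j \<otimes>\<^bsub>G\<^esub> x) [0..<c] \<one>\<^bsub>G\<^esub>)"
      by (simp add: row i)
    also have "\<dots> = (\<Sum>j\<leftarrow>[0..<c]. \<phi> (?u j))"
      using T u by (intro jordan_additive_foldr[OF assms(3) two]) auto
    also have "\<dots> = (\<Sum>j = 0..<c. A $$ (i, j) * \<phi> (T j))"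
      using T by (simp add: interv_sum_list_conv_sum_set_nat pow t)
    also have "\<dots> = (\<Sum>j = 0..<c. A $$ (i, j) * (\<phi> (T j) / \<phi> J)) * \<phi> J"
      using J by (simp add: sum_distrib_right)
    also have "(\<Sum>j = 0..<c. A $$ (i, j) * (\<phi> (T j) / \<phi> J)) = (A *\<^sub>v x) $ i"
      using A i by (simp add: x_def scalar_prod_def)
    finally show ?thesis using J by simp
  qed
  then have "A *\<^sub>v x = b" using A b by auto
  moreover have "x \<in> carrier_vec c" by (simp add: x_def)
  ultimately show ?thesis using has_solution_Zp[OF A b] by blast
qed

section \<open>Direct products and central quotients\<close>

lemma jordan_additive_product_group:
  assumes "\<And>i. i \<in> I \<Longrightarrow> jordan_additive (G i) (\<phi> i)"
  shows "jordan_additive (product_group I G) (\<lambda>f. \<Sum>i\<in>I. \<phi> i (f i))"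
  unfolding jordan_additive_def
proof (intro ballI)
  fix f g assume fg: "f \<in> carrier (product_group I G)" "g \<in> carrier (product_group I G)"
  have "(\<Sum>i\<in>I. \<phi> i (f i \<otimes>\<^bsub>G i\<^esub> g i) + \<phi> i (g i \<otimes>\<^bsub>G i\<^esub> f i)) =
    (\<Sum>i\<in>I. 2 * (\<phi> i (f i) + \<phi> i (g i)))"
    using assms fg by (intro sum.cong) (auto simp: jordan_additive_def PiE_iff)
  then show "(\<Sum>i\<in>I. \<phi> i ((f \<otimes>\<^bsub>product_group I G\<^esub> g) i)) +
    (\<Sum>i\<in>I. \<phi> i ((g \<otimes>\<^bsub>product_group I G\<^esub> f) i)) =
    2 * ((\<Sum>i\<in>I. \<phi> i (f i)) + (\<Sum>i\<in>I. \<phi> i (g i)))"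
    by (simp add: sum.distrib sum_distrib_left distrib_left)
qed

text \<open>
  A coset has the value of any of its elements: representatives differ by a central factor,
  which commutes with everything and has value 0.  The choice of representative made in
  \<open>jordan_additive_FactGroup\<close> is therefore immaterial.
\<close>

lemma (in normal) some_rcoset_eq:
  fixes \<phi> :: "'a \<Rightarrow> 'f::field"
  assumes "jordan_additive G \<phi>" "(2::'f) \<noteq> 0"
    and "H \<subseteq> center G" "\<And>h. h \<in> H \<Longrightarrow> \<phi> h = 0" "x \<in> carrier G"
  shows "\<phi> (SOME y. y \<in> H #> x) = \<phi> x"
proof -
  have "(SOME y. y \<in> H #> x) \<in> H #> x"
    using rcos_self[OF assms(5)] by (metis someI subgroup_axioms)
  then obtain h where h: "h \<in> H" "(SOME y. y \<in> H #> x) = h \<otimes> x"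
    unfolding r_coset_def by auto
  then have "\<phi> (h \<otimes> x) = \<phi> h + \<phi> x"
    using assms by (intro jordan_additive_mult_commuting) (blast dest: center_carrier center_commute)+
  with h assms(4) show ?thesis by simp
qed

lemma (in normal) jordan_additive_FactGroup:
  fixes \<phi> :: "'a \<Rightarrow> 'f::field"
  assumes "jordan_additive G \<phi>" "(2::'f) \<noteq> 0"
    and "H \<subseteq> center G" "\<And>h. h \<in> H \<Longrightarrow> \<phi> h = 0"
  shows "jordan_additive (G Mod H) (\<lambda>C. \<phi> (SOME y. y \<in> C))"
  unfolding jordan_additive_def
proof (intro ballI)
  fix C D assume "C \<in> carrier (G Mod H)" "D \<in> carrier (G Mod H)"
  then obtain x y where x: "x \<in> carrier G" "C = H #> x" and y: "y \<in> carrier G" "D = H #> y"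
    by (auto simp: carrier_FactGroup)
  have "\<phi> (x \<otimes> y) + \<phi> (y \<otimes> x) = 2 * (\<phi> x + \<phi> y)"
    using assms(1) x(1) y(1) unfolding jordan_additive_def by blast
  then show "\<phi> (SOME z. z \<in> C \<otimes>\<^bsub>G Mod H\<^esub> D) + \<phi> (SOME z. z \<in> D \<otimes>\<^bsub>G Mod H\<^esub> C) =
    2 * (\<phi> (SOME z. z \<in> C) + \<phi> (SOME z. z \<in> D))"
    unfolding x(2) y(2) mult_FactGroup rcos_sum[OF x(1) y(1)] rcos_sum[OF y(1) x(1)]
    using some_rcoset_eq[OF assms] x(1) y(1) by simp
qed

lemma (in group) center_subgroup: "subgroup (center G) G"
proof (rule subgroupI)
  show "center G \<subseteq> carrier G" by (blast dest: center_carrier)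
  have "\<one> \<in> center G" by (rule centerI) simp_all
  then show "center G \<noteq> {}" by blast
next
  fix a assume a: "a \<in> center G"
  then have ac: "a \<in> carrier G" by (rule center_carrier)
  show "inv a \<in> center G"
  proof (rule centerI)
    fix g assume g: "g \<in> carrier G"
    then have "inv (inv g \<otimes> a) = inv (a \<otimes> inv g)" using center_commute[OF a, of "inv g"] by simp
    then show "inv a \<otimes> g = g \<otimes> inv a" using ac g by (simp add: inv_mult_group)
  qed (use ac in simp)
next
  fix a b assume ab: "a \<in> center G" "b \<in> center G"
  then have c: "a \<in> carrier G" "b \<in> carrier G" by (simp_all add: center_carrier)
  show "a \<otimes> b \<in> center G"
  proof (rule centerI)
    fix g assume g: "g \<in> carrier G"
    then show "a \<otimes> b \<otimes> g = g \<otimes> (a \<otimes> b)"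
      using c center_commute[OF ab(1) g] center_commute[OF ab(2) g] by (metis m_assoc)
  qed (use c in simp)
qed

lemma (in group) comm_group_center: "comm_group (G\<lparr>carrier := center G\<rparr>)"
proof -
  interpret C: group "G\<lparr>carrier := center G\<rparr>"
    using center_subgroup subgroup_imp_group by blast
  show ?thesis
  proof (rule C.group_comm_groupI)
    fix x y assume "x \<in> carrier (G\<lparr>carrier := center G\<rparr>)" "y \<in> carrier (G\<lparr>carrier := center G\<rparr>)"
    then have "x \<otimes> y = y \<otimes> x" by (simp add: center_commute center_carrier)
    then show "x \<otimes>\<^bsub>G\<lparr>carrier := center G\<rparr>\<^esub> y = y \<otimes>\<^bsub>G\<lparr>carrier := center G\<rparr>\<^esub> x" by simp
  qed
qed

lemma (in group) central_subgroup_normal: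
  assumes "subgroup N G" "N \<subseteq> center G"
  shows "N \<lhd> G"
proof (rule normal_invI[OF assms(1)])
  fix x h assume xh: "x \<in> carrier G" "h \<in> N"
  then have "h \<in> carrier G" "x \<otimes> h = h \<otimes> x" 
    using assms by (blast dest: center_carrier, metis center_commute subsetD)
  then have "x \<otimes> h \<otimes> inv x = h" using xh by (simp add: m_assoc)
  then show "x \<otimes> h \<otimes> inv x \<in> N" using xh by simp
qed

lemma (in group) central_mem_center_FactGroup:
  assumes "N \<lhd> G" "z \<in> center G"
  shows "N #> z \<in> center (G Mod N)"
proof -
  have z: "z \<in> carrier G" using assms(2) by (rule center_carrier)
  show ?thesis
  proof (rule centerI)
    fix C assume "C \<in> carrier (G Mod N)"
    then obtain g where g: "g \<in> carrier G" "C = N #> g" by (auto simp: carrier_FactGroup)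
    then show "(N #> z) \<otimes>\<^bsub>G Mod N\<^esub> C = C \<otimes>\<^bsub>G Mod N\<^esub> (N #> z)"
      using z center_commute[OF assms(2) g(1)] by (simp add: normal.rcos_sum[OF assms(1)])
  qed (use z in \<open>auto simp: carrier_FactGroup\<close>)
qed

lemma PiE_center_subset_center_product_group:
  "(\<Pi>\<^sub>E i\<in>I. center (G i)) \<subseteq> center (product_group I G)"
proof
  fix z assume z: "z \<in> (\<Pi>\<^sub>E i\<in>I. center (G i))"
  show "z \<in> center (product_group I G)"
  proof (rule centerI)
    show "z \<in> carrier (product_group I G)" using z by (auto simp: PiE_iff center_carrier)
  next
    fix g assume "g \<in> carrier (product_group I G)"
    then have "z i \<otimes>\<^bsub>G i\<^esub> g i = g i \<otimes>\<^bsub>G i\<^esub> z i" if "i \<in> I" for i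
      using z that by (intro center_commute) (auto simp: PiE_iff)
    then show "z \<otimes>\<^bsub>product_group I G\<^esub> g = g \<otimes>\<^bsub>product_group I G\<^esub> z"
      unfolding mult_product_group by (intro restrict_ext)
  qed
qed

text \<open>
  The subgroup that is divided out in \<open>central_power\<close>.  For two factors it is the image of the
  center under \<open>z \<mapsto> (z, z\<inverse>)\<close>.
\<close>

abbreviation antidiagonal_center :: "('g, 'm) monoid_scheme \<Rightarrow> nat \<Rightarrow> (nat \<Rightarrow> 'g) set"
  where "antidiagonal_center G n \<equiv>
    {z \<in> {..<n} \<rightarrow>\<^sub>E center G. finprod (G\<lparr>carrier := center G\<rparr>) z {..<n} = \<one>\<^bsub>G\<^esub>}"

lemma (in group) antidiagonal_center_normal:
  "antidiagonal_center G n \<lhd> product_group {..<n} (\<lambda>_. G)"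
proof -
  let ?P = "product_group {..<n} (\<lambda>_. G)" and ?Z = "G\<lparr>carrier := center G\<rparr>"
  interpret Z: comm_group ?Z by (rule comm_group_center)
  interpret P: group ?P using group_axioms by simp
  interpret center: subgroup "center G" G by (rule center_subgroup)
  have prod: "finprod ?Z (\<lambda>i\<in>{..<n}. f i \<otimes> g i) {..<n} = finprod ?Z f {..<n} \<otimes> finprod ?Z g {..<n}"
    if "f \<in> {..<n} \<rightarrow> center G" "g \<in> {..<n} \<rightarrow> center G" for f g
  proof -
    have "finprod ?Z (\<lambda>i\<in>{..<n}. f i \<otimes> g i) {..<n} = finprod ?Z (\<lambda>i. f i \<otimes> g i) {..<n}"
      using that by (intro Z.finprod_cong') auto
    also have "\<dots> = finprod ?Z f {..<n} \<otimes> finprod ?Z g {..<n}"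
      using Z.finprod_multf[of f "{..<n}" g] that by simp
    finally show ?thesis .
  qed
  have one: "finprod ?Z (\<lambda>i\<in>{..<n}. \<one>) {..<n} = \<one>"
    using Z.finprod_one_eqI[of "{..<n}" "\<lambda>i\<in>{..<n}. \<one>"] by simp
  have closed: "finprod ?Z f {..<n} \<in> center G" if "f \<in> {..<n} \<rightarrow> center G" for f
    using Z.finprod_closed[of f "{..<n}"] that by simp
  have sub: "(\<Pi>\<^sub>E i\<in>{..<n}. center G) \<subseteq> (\<Pi>\<^sub>E i\<in>{..<n}. carrier G)"
    by (intro PiE_mono center.subset)
  have "subgroup (antidiagonal_center G n) ?P"
  proof (rule P.subgroupI)
    show "antidiagonal_center G n \<subseteq> carrier ?P" using sub by auto
  next
    have "(\<lambda>i\<in>{..<n}. \<one>) \<in> antidiagonal_center G n"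
      using one by (simp add: restrict_PiE_iff)
    then show "antidiagonal_center G n \<noteq> {}" by blast
  next
    fix f assume f: "f \<in> antidiagonal_center G n"
    let ?g = "\<lambda>i\<in>{..<n}. inv (f i)"
    have fc: "f \<in> {..<n} \<rightarrow> center G" using f unfolding PiE_def by blast
    then have gc: "?g \<in> {..<n} \<rightarrow> center G" by auto
    have f1: "finprod ?Z f {..<n} = \<one>" using f by blast
    have fg: "(\<lambda>i\<in>{..<n}. f i \<otimes> ?g i) = (\<lambda>i\<in>{..<n}. \<one>)"
    proof (rule restrict_ext)
      fix i assume i: "i \<in> {..<n}"
      then have "f i \<in> carrier G" using fc center.mem_carrier by blast
      then show "f i \<otimes> ?g i = \<one>" using i by simp
    qed
    have "\<one> = finprod ?Z f {..<n} \<otimes> finprod ?Z ?g {..<n}"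
      unfolding prod[OF fc gc, symmetric] fg one ..
    also have "\<dots> = finprod ?Z ?g {..<n}"
      unfolding f1 by (rule l_one[OF center.mem_carrier[OF closed[OF gc]]])
    finally have "finprod ?Z ?g {..<n} = \<one>" by (rule sym)
    moreover have "?g \<in> {..<n} \<rightarrow>\<^sub>E center G"
      using fc unfolding restrict_PiE_iff by (auto intro: center.m_inv_closed)
    moreover have inv: "inv\<^bsub>?P\<^esub> f = ?g"
    proof (rule inv_product_group)
      show "f \<in> (\<Pi>\<^sub>E i\<in>{..<n}. carrier G)" using f sub by blast
    qed (rule group_axioms)
    ultimately show "inv\<^bsub>?P\<^esub> f \<in> antidiagonal_center G n" unfolding inv by blast
  next
    fix f g assume fg: "f \<in> antidiagonal_center G n" "g \<in> antidiagonal_center G n"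
    have fgc: "f \<in> {..<n} \<rightarrow> center G" "g \<in> {..<n} \<rightarrow> center G"
      using fg unfolding PiE_def by blast+
    have "finprod ?Z f {..<n} = \<one>" "finprod ?Z g {..<n} = \<one>" using fg by blast+
    then have "finprod ?Z (f \<otimes>\<^bsub>?P\<^esub> g) {..<n} = \<one>"
      unfolding mult_product_group prod[OF fgc] by simp
    moreover have "f \<otimes>\<^bsub>?P\<^esub> g \<in> {..<n} \<rightarrow>\<^sub>E center G"
      unfolding mult_product_group restrict_PiE_iff using fgc by auto
    ultimately show "f \<otimes>\<^bsub>?P\<^esub> g \<in> antidiagonal_center G n" by blast
  qed
  then show ?thesis
    using PiE_center_subset_center_product_group[of "{..<n}" "\<lambda>_. G"]
    by (intro P.central_subgroup_normal) auto
qed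

text \<open>
  On the center \<open>\<phi>\<close> is a homomorphism, so that the sum of its values over a tuple in the
  antidiagonal is \<open>\<phi> \<one> = 0\<close>.
\<close>

lemma (in group) jordan_additive_finprod_center:
  fixes \<phi> :: "'a \<Rightarrow> 'f::field"
  assumes "jordan_additive G \<phi>" "(2::'f) \<noteq> 0" "finite I" "z \<in> I \<rightarrow> center G"
  shows "\<phi> (finprod (G\<lparr>carrier := center G\<rparr>) z I) = (\<Sum>i\<in>I. \<phi> (z i))"
proof -
  interpret Z: comm_group "G\<lparr>carrier := center G\<rparr>" by (rule comm_group_center)
  show ?thesis using assms(3,4)
  proof (induction I)
    case empty
    then show ?case by (simp add: jordan_additive_one[OF assms(1,2)])
  next
    case (insert i I)
    have zi: "z i \<in> center G" and "finprod (G\<lparr>carrier := center G\<rparr>) z I \<in> center G"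
      using insert.prems Z.finprod_closed[of z I] by auto
    then have "\<phi> (z i \<otimes> finprod (G\<lparr>carrier := center G\<rparr>) z I) =
      \<phi> (z i) + \<phi> (finprod (G\<lparr>carrier := center G\<rparr>) z I)"
      by (intro jordan_additive_mult_commuting[OF assms(1,2)]) (blast dest: center_carrier center_commute)+
    with insert zi show ?case by simp
  qed
qed

text \<open>
  The sum of \<open>\<phi>\<close> over the factors descends to the central power.  The central element
  \<open>Z\<close> records that no value of \<open>\<phi>\<close> on the center is lost: it is the class of the tuple
  with \<open>z\<close> in one factor, which requires that there is at least one.
\<close>

lemma (in group) jordan_additive_central_power:
  fixes \<phi> :: "'a \<Rightarrow> 'f::field"
  assumes "jordan_additive G \<phi>" "(2::'f) \<noteq> 0" and n: "n \<ge> 1" and z: "z \<in> center G"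
  obtains \<psi> :: "(nat \<Rightarrow> 'a) set \<Rightarrow> 'f" and Z
  where "jordan_additive (central_power G n) \<psi>" "Z \<in> center (central_power G n)" "\<psi> Z = \<phi> z"
proof -
  let ?P = "product_group {..<n} (\<lambda>_. G)" and ?N = "antidiagonal_center G n"
  let ?\<Phi> = "\<lambda>f. \<Sum>i<n. \<phi> (f i)"
  interpret P: group ?P using group_axioms by simp
  interpret N: normal ?N ?P by (rule antidiagonal_center_normal)
  have \<Phi>: "jordan_additive ?P ?\<Phi>"
    using assms(1) by (rule jordan_additive_product_group)
  have central: "?N \<subseteq> center ?P"
    using PiE_center_subset_center_product_group[of "{..<n}" "\<lambda>_. G"] by auto
  have vanish: "?\<Phi> f = 0" if "f \<in> ?N" for f
    using that jordan_additive_finprod_center[OF assms(1,2), of "{..<n}" f]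
      jordan_additive_one[OF assms(1,2)] by (auto simp: PiE_iff)
  define \<zeta> where "\<zeta> = (\<lambda>i\<in>{..<n}. if i = 0 then z else \<one>)"
  have "\<zeta> \<in> (\<Pi>\<^sub>E i\<in>{..<n}. center G)"
    using z center_subgroup by (auto simp: \<zeta>_def subgroup.one_closed)
  then have \<zeta>: "\<zeta> \<in> center ?P"
    by (rule subsetD[OF PiE_center_subset_center_product_group])
  have "?\<Phi> \<zeta> = (\<Sum>i<n. if i = 0 then \<phi> z else 0)"
  proof (rule sum.cong)
    fix i assume "i \<in> {..<n}"
    then show "\<phi> (\<zeta> i) = (if i = 0 then \<phi> z else 0)"
      by (simp add: \<zeta>_def jordan_additive_one[OF assms(1,2)])
  qed (rule refl)
  also have "\<dots> = \<phi> z" using n by (simp add: sum.delta)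
  finally have "?\<Phi> \<zeta> = \<phi> z" .
  moreover have "?\<Phi> (SOME y. y \<in> ?N #>\<^bsub>?P\<^esub> \<zeta>) = ?\<Phi> \<zeta>"
    by (rule N.some_rcoset_eq[OF \<Phi> assms(2) central vanish center_carrier[OF \<zeta>]])
  ultimately have "?\<Phi> (SOME y. y \<in> ?N #>\<^bsub>?P\<^esub> \<zeta>) = \<phi> z" by (rule trans[rotated])
  moreover have "jordan_additive (?P Mod ?N) (\<lambda>C. ?\<Phi> (SOME y. y \<in> C))"
    by (rule N.jordan_additive_FactGroup[OF \<Phi> assms(2) central vanish])
  moreover have "?N #>\<^bsub>?P\<^esub> \<zeta> \<in> center (?P Mod ?N)"
    by (rule P.central_mem_center_FactGroup[OF antidiagonal_center_normal \<zeta>])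
  ultimately show thesis
    using that[of "\<lambda>C. ?\<Phi> (SOME y. y \<in> C)" "?N #>\<^bsub>?P\<^esub> \<zeta>", unfolded central_power_def]
    by blast
qed

section \<open>The Heisenberg group\<close>

definition heis :: "'a \<Rightarrow> 'a \<Rightarrow> 'a \<Rightarrow> 'a::field mat"
  where "heis a b c = mat 3 3 (\<lambda>(i, j). if i = j then 1 else if i = 0 \<and> j = 1 then a
    else if i = 1 \<and> j = 2 then b else if i = 0 \<and> j = 2 then c else 0)"

lemma less_3_cases: "i < 3 \<longleftrightarrow> i = 0 \<or> i = 1 \<or> i = (2::nat)"
  by auto

lemma heis_entries [simp]:
  "heis a b c $$ (0, Suc 0) = a" "heis a b c $$ (Suc 0, 2) = b" "heis a b c $$ (0, 2) = c"
  by (auto simp: heis_def)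

lemma heis_mult: "heis a b c * heis a' b' c' = heis (a + a') (b + b') (c + c' + a * b')"
  by (rule eq_matI) (auto simp: heis_def scalar_prod_def less_3_cases numeral_3_eq_3)

lemma carrier_E1_plus: "carrier E1_plus = {heis a b c |a b c. True}"
proof (intro equalityI subsetI)
  fix M :: "'a mod_ring mat" assume "M \<in> carrier E1_plus"
  then have "M = heis (M $$ (0, 1)) (M $$ (1, 2)) (M $$ (0, 2))"
    by (intro eq_matI) (auto simp: E1_plus_def heis_def less_3_cases upper_triangular_def)
  then show "M \<in> {heis a b c |a b c. True}" by blast
qed (auto simp: E1_plus_def heis_def upper_triangular_def)

lemma mult_E1_plus: "x \<otimes>\<^bsub>E1_plus\<^esub> y = x * y"
  by (simp add: E1_plus_def)

lemma one_E1_plus: "\<one>\<^bsub>E1_plus\<^esub> = heis 0 0 0"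
  unfolding E1_plus_def by (auto simp: heis_def intro!: eq_matI)

lemma group_E1_plus: "group (E1_plus :: 'p::prime_card mod_ring mat monoid)"
proof (rule groupI)
  fix x :: "'p mod_ring mat" assume "x \<in> carrier E1_plus"
  then obtain a b c where x: "x = heis a b c" by (auto simp: carrier_E1_plus)
  have "heis (- a) (- b) (a * b - c) * x = heis 0 0 0" by (simp add: x heis_mult)
  then show "\<exists>y\<in>carrier E1_plus. y \<otimes>\<^bsub>E1_plus\<^esub> x = \<one>\<^bsub>E1_plus\<^esub>"
    unfolding mult_E1_plus one_E1_plus carrier_E1_plus by blast
qed (unfold carrier_E1_plus mult_E1_plus one_E1_plus, auto simp: heis_mult algebra_simps, blast+)

text \<open>
  The corner entry of the logarithm \<open>N - N\<^sup>2 / 2\<close> of the unipotent matrix \<open>M = 1 + N\<close>.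
\<close>

definition heis_log :: "'a::field mat \<Rightarrow> 'a"
  where "heis_log M = M $$ (0, 2) - M $$ (0, 1) * M $$ (1, 2) / 2"

text \<open>
  The corner entry of a product contains the asymmetric term \<open>a b'\<close>; the correction
  \<open>- (a + a') (b + b') / 2\<close> leaves \<open>(a b' - a' b) / 2\<close> of it, which changes sign when the factors
  are exchanged.
\<close>

lemma jordan_additive_heis_log:
  assumes "(2::'p::prime_card mod_ring) \<noteq> 0"
  shows "jordan_additive E1_plus (heis_log :: 'p mod_ring mat \<Rightarrow> 'p mod_ring)"
  unfolding jordan_additive_def carrier_E1_plus mult_E1_plus
  using assms by (auto simp: heis_mult heis_log_def field_simps)

lemma heis_center: "heis 0 0 (1::'p::prime_card mod_ring) \<in> center E1_plus"
  by (rule centerI) (auto simp: carrier_E1_plus mult_E1_plus heis_mult add.commute)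

section \<open>Solutions in extraspecial groups\<close>

theorem corollary4p11:
  fixes A :: "'p::prime_card mod_ring mat"
    and b :: "'p mod_ring vec"
    and r c n :: nat
    and J\<^sub>E :: "(nat \<Rightarrow> 'p mod_ring mat) set"
  assumes "CARD('p) > 2"
    and "n \<ge> 1"
    and "A \<in> carrier_mat r c"
    and "b \<in> carrier_vec r"
    and "J\<^sub>E \<in> center (E_plus n)"
    and "generate (E_plus n) {J\<^sub>E} = center (E_plus n)"
    and "has_solution (E_plus n) J\<^sub>E A b"
  shows "has_solution (integer_mod_group CARD('p)) 1 A b"
proof -
  let ?E = "E_plus n :: (nat \<Rightarrow> 'p mod_ring mat) set monoid"
  note two = two_neq_zero_mod_ring[OF assms(1)]
  interpret E1: group "E1_plus :: 'p mod_ring mat monoid" by (rule group_E1_plus)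
  interpret E: group ?E
    unfolding E_plus_def central_power_def
    by (rule normal.factorgroup_is_group[OF E1.antidiagonal_center_normal])
  obtain \<psi> :: "(nat \<Rightarrow> 'p mod_ring mat) set \<Rightarrow> 'p mod_ring" and Z
    where \<psi>: "jordan_additive ?E \<psi>" "Z \<in> center ?E" "\<psi> Z = heis_log (heis 0 0 (1::'p mod_ring))"
    using E1.jordan_additive_central_power[OF jordan_additive_heis_log[OF two] two assms(2) heis_center]
    unfolding E_plus_def by blast
  have J: "J\<^sub>E \<in> carrier ?E" using assms(5) by (rule center_carrier)
  \<comment> \<open>A generator of the center cannot have value 0, because the central element \<open>Z\<close> has value 1.\<close>
  obtain k :: int where "Z = J\<^sub>E [^]\<^bsub>?E\<^esub> k"
    using \<psi>(2) E.generate_pow[OF J] assms(6) by auto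
  then have "of_int k * \<psi> J\<^sub>E = 1"
    using \<psi>(3) E.jordan_additive_int_pow[OF \<psi>(1) two J] by (simp add: heis_log_def)
  then have "\<psi> J\<^sub>E \<noteq> 0" by auto
  with has_solution_Zp_if_jordan_additive[OF assms(1) E.group_axioms \<psi>(1) J _ assms(3,4,7)]
  show ?thesis .
qed

end
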